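(* In the space of finitely generated marked groups, the set of all marked groups whose underlying group admits an isolated left-invariant linear order is neither closed nor open.
   Context: Marked groups: for $k\geq 1$, a marked group on $k$ generators is a pair $(G,(g_1,\dots,g_k))$ where $G$ is a group generated by the ordered $k$-tuple $(g_1,\dots,g_k)$, up to isomorphisms respecting the ordered tuples. Equivalently, it is a normal subgroup $N$ of the free group $F_k$ on $k$ fixed free generators (with $G\cong F_k/N$). The space $\mathcal{G}_k$ of marked groups on $k$ generators is the set of normal subgroups of $F_k$, with the topology induced from the product topology on $\{0,1\}^{F_k}$. The space of finitely generated marked groups is the union of the spaces $\mathcal{G}_k$, $k\ge 1$, in which each $\mathcal{G}_k$ is open and closed (e.g. the disjoint union $\bigsqcup_{k\geq 1}\mathcal{G}_k$). Linear orders: a (left-invariant) linear order on a group $G$ is a total order $\preceq$ on the set $G$ such that $g\preceq h$ implies $kg\preceq kh$ for all $g,h,k\in G$. The space $\mathrm{LO}(G)$ is the set of all left-invariant linear orders on $G$, with the topology generated by the sets $$U_{(\preceq,X)}=\{\preceq' \;\mid\; x\preceq' y \text{ if and only if } x\preceq y \text{ for all } x,y\in X\},$$ where $\preceq$ ranges over $\mathrm{LO}(G)$ and $X$ ranges over finite subsets of $G$. An isolated linear order on $G$ is an isolated point of $\mathrm{LO}(G)$. *)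

theory Defs
  imports "HOL-Analysis.Analysis" "HOL-Algebra.Coset"
begin

text \<open>Letters are pairs: \<open>(i, True)\<close> is the generator with index \<open>i\<close> and \<open>(i, False)\<close> its
  formal inverse. Elements of the free group are the reduced words in the letters with index
  \<open>i < k\<close>; the product is concatenation followed by free reduction.\<close>

type_synonym letter = "nat \<times> bool"

definition inv_letter :: "letter \<Rightarrow> letter" where
  "inv_letter a = (fst a, \<not> snd a)"

definition reduced :: "letter list \<Rightarrow> bool" where
  "reduced w \<longleftrightarrow> successively (\<lambda>a b. b \<noteq> inv_letter a) w"

fun cancel_cons :: "letter \<Rightarrow> letter list \<Rightarrow> letter list" where
  "cancel_cons a [] = [a]"
| "cancel_cons a (b # w) = (if b = inv_letter a then w else a # b # w)"

definition free_group :: "nat \<Rightarrow> letter list monoid" where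
  "free_group k =
     \<lparr>carrier = {w. reduced w \<and> (\<forall>a \<in> set w. fst a < k)},
      mult = (\<lambda>u v. foldr cancel_cons u v),
      one = []\<rparr>"

lemma inv_letter_simps [simp]:
  "inv_letter (inv_letter a) = a" "fst (inv_letter a) = fst a" "inv_letter a \<noteq> a"
  "a \<noteq> inv_letter a"
  by (auto simp: inv_letter_def prod_eq_iff)

lemma reduced_Cons:
  "reduced (a # w) \<longleftrightarrow> reduced w \<and> (w \<noteq> [] \<longrightarrow> hd w \<noteq> inv_letter a)"
  by (auto simp: reduced_def successively_Cons)

lemma reduced_cancel_cons: "reduced w \<Longrightarrow> reduced (cancel_cons a w)"
  by (cases w) (auto simp: reduced_Cons)

lemma reduced_foldr: "reduced w \<Longrightarrow> reduced (foldr cancel_cons u w)"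
  by (induction u) (auto simp: reduced_cancel_cons)

lemma set_cancel_cons: "set (cancel_cons a w) \<subseteq> insert a (set w)"
  by (cases w) auto

lemma set_foldr_cancel_cons: "set (foldr cancel_cons u w) \<subseteq> set u \<union> set w"
proof (induction u)
  case (Cons a u)
  then show ?case using set_cancel_cons[of a "foldr cancel_cons u w"] by auto
qed simp

lemma cancel_cons_inverse:
  "reduced w \<Longrightarrow> cancel_cons a (cancel_cons (inv_letter a) w) = w"
proof (cases w)
  case (Cons b v)
  assume "reduced w"
  with Cons show ?thesis by (cases v) (auto simp: reduced_Cons)
qed simp

lemma foldr_cancel_cons:
  assumes "reduced w"
  shows "foldr cancel_cons (cancel_cons a u) w = cancel_cons a (foldr cancel_cons u w)"
  using assms by (cases u) (auto simp: cancel_cons_inverse reduced_foldr)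

lemma foldr_cancel_cons_assoc:
  assumes "reduced w"
  shows "foldr cancel_cons (foldr cancel_cons u v) w = foldr cancel_cons u (foldr cancel_cons v w)"
  using assms by (induction u) (auto simp: foldr_cancel_cons)

lemma foldr_cancel_cons_inv:
  "foldr cancel_cons (map inv_letter (rev u)) u = []"
  by (induction u) auto

lemma reduced_inv: "reduced u \<Longrightarrow> reduced (map inv_letter (rev u))"
  unfolding reduced_def successively_map successively_rev
  by (erule successively_mono) (metis inv_letter_simps(1))

lemma foldr_cancel_cons_Nil: "reduced u \<Longrightarrow> foldr cancel_cons u [] = u"
proof (induction u)
  case (Cons a u)
  then show ?case by (cases u) (auto simp: reduced_Cons)
qed simp

lemma group_free_group: "group (free_group k)"
proof (rule groupI)
  fix x y assume "x \<in> carrier (free_group k)" "y \<in> carrier (free_group k)"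
  then show "x \<otimes>\<^bsub>free_group k\<^esub> y \<in> carrier (free_group k)"
    using set_foldr_cancel_cons[of x y] by (auto simp: free_group_def reduced_foldr)
next
  fix x assume "x \<in> carrier (free_group k)"
  then show "\<exists>y \<in> carrier (free_group k). y \<otimes>\<^bsub>free_group k\<^esub> x = \<one>\<^bsub>free_group k\<^esub>"
    by (intro bexI[of _ "map inv_letter (rev x)"])
       (auto simp: free_group_def reduced_inv foldr_cancel_cons_inv)
qed (auto simp: free_group_def foldr_cancel_cons_assoc reduced_def)

text \<open>The universal property of \<open>free_group k\<close> with respect to the generators \<open>[(i, True)]\<close>.\<close>

lemma generator_in_free_group: "i < k \<Longrightarrow> [(i, b)] \<in> carrier (free_group k)"
  by (simp add: free_group_def reduced_def)

lemma inv_generator_free_group: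
  assumes "i < k"
  shows "inv\<^bsub>free_group k\<^esub> [(i, True)] = [(i, False)]"
  using assms
  by (intro group.inv_equality[OF group_free_group])
     (auto simp: generator_in_free_group, simp add: free_group_def inv_letter_def)

definition word_value :: "('a, 'b) monoid_scheme \<Rightarrow> (nat \<Rightarrow> 'a) \<Rightarrow> letter list \<Rightarrow> 'a" where
  "word_value H g w =
     foldr (\<lambda>a y. (if snd a then g (fst a) else inv\<^bsub>H\<^esub> (g (fst a))) \<otimes>\<^bsub>H\<^esub> y) w \<one>\<^bsub>H\<^esub>"

lemma word_value_hom:
  assumes "group H" and g: "\<And>i. i < k \<Longrightarrow> g i \<in> carrier H"
  shows "word_value H g \<in> hom (free_group k) H"
proof -
  interpret group H by fact
  let ?e = "word_value H g"
  have closed: "?e w \<in> carrier H" if "\<forall>a \<in> set w. fst a < k" for w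
    using that by (induction w) (auto simp: word_value_def g)
  have cc: "?e (cancel_cons a w) = ?e [a] \<otimes>\<^bsub>H\<^esub> ?e w"
    if "fst a < k" "\<forall>a \<in> set w. fst a < k" for a w
  proof (cases w)
    case Nil
    with that show ?thesis by (auto simp: word_value_def g)
  next
    case (Cons b v)
    with that closed[of v] show ?thesis
      by (auto simp: word_value_def g inv_letter_def m_assoc[symmetric])
  qed
  have split: "?e (a # w) = ?e [a] \<otimes>\<^bsub>H\<^esub> ?e w"
    if "fst a < k" "\<forall>a \<in> set w. fst a < k" for a w
    using that by (auto simp: word_value_def g)
  have "?e (foldr cancel_cons u v) = ?e u \<otimes>\<^bsub>H\<^esub> ?e v"
    if "\<forall>a \<in> set u. fst a < k" "\<forall>a \<in> set v. fst a < k" for u v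
    using that(1)
  proof (induction u)
    case Nil
    then show ?case using closed[OF that(2)] by (simp add: word_value_def)
  next
    case (Cons a u)
    have "\<forall>a \<in> set (foldr cancel_cons u v). fst a < k"
      using set_foldr_cancel_cons[of u v] Cons.prems that(2) by auto
    then show ?case
      using Cons cc[of a "foldr cancel_cons u v"] split[of a u] closed[of "[a]"] closed[of u]
        closed[OF that(2)] by (simp add: m_assoc)
  qed
  then show ?thesis
    using closed by (auto simp: hom_def free_group_def)
qed

theorem free_group_universal:
  assumes H: "group H" and g: "\<And>i. i < k \<Longrightarrow> g i \<in> carrier H"
  shows "\<exists>f \<in> hom (free_group k) H. (\<forall>i<k. f [(i, True)] = g i) \<and>
           (\<forall>f' \<in> hom (free_group k) H. (\<forall>i<k. f' [(i, True)] = g i) \<longrightarrow>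
              (\<forall>w \<in> carrier (free_group k). f' w = f w))"
proof (intro bexI[OF _ word_value_hom[OF H g]] conjI allI impI ballI)
  interpret group H by fact
  fix i assume "i < k"
  then show "word_value H g [(i, True)] = g i" by (simp add: word_value_def g)
next
  interpret group H by fact
  fix f w
  assume f: "f \<in> hom (free_group k) H" and gen: "\<forall>i<k. f [(i, True)] = g i"
    and "w \<in> carrier (free_group k)"
  interpret F: group_hom "free_group k" H f
    using f by (simp add: group_hom_def group_hom_axioms_def group_free_group H)
  show "f w = word_value H g w"
    using \<open>w \<in> carrier (free_group k)\<close>
  proof (induction w)
    case Nil
    then show ?case using F.hom_one by (simp add: free_group_def word_value_def)
  next
    case (Cons a w)
    then have a: "[a] \<in> carrier (free_group k)" and w: "w \<in> carrier (free_group k)"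
      and ak: "fst a < k"
      by (auto simp: free_group_def reduced_def successively_Cons)
    have "a # w = [a] \<otimes>\<^bsub>free_group k\<^esub> w"
      using Cons.prems by (cases w) (auto simp: free_group_def reduced_Cons)
    then have 1: "f (a # w) = f [a] \<otimes>\<^bsub>H\<^esub> f w"
      using F.hom_mult[OF a w] by simp
    have "f [a] = (if snd a then g (fst a) else inv\<^bsub>H\<^esub> (g (fst a)))"
      using gen ak inv_generator_free_group[OF ak] F.hom_inv[OF generator_in_free_group[OF ak]]
      by (cases a) (metis fst_conv snd_conv)
    then show ?case using 1 Cons.IH[OF w] by (simp add: word_value_def)
  qed
qed

text \<open>A marked group on \<open>k\<close> generators is a normal subgroup \<open>N\<close> of \<open>free_group k\<close>, standing for
  the group \<open>free_group k Mod N\<close> marked by the cosets of \<open>[(0, True)], \<dots>, [(k - 1, True)]\<close>. The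
  topology is induced from the product of discrete two-point spaces along
  \<open>N \<mapsto>\<close> (indicator of \<open>N\<close>); the indicator is restricted because points of a
  \<open>product_topology\<close> are extensional functions.\<close>

definition marked_groups_on :: "nat \<Rightarrow> letter list set topology" where
  "marked_groups_on k =
     pullback_topology {N. N \<lhd> free_group k}
       (\<lambda>N. \<lambda>x \<in> carrier (free_group k). x \<in> N)
       (product_topology (\<lambda>_. discrete_topology (UNIV :: bool set)) (carrier (free_group k)))"

definition marked_groups :: "(nat \<times> letter list set) topology" where
  "marked_groups = sum_topology marked_groups_on {1..}"

definition underlying_group :: "nat \<times> letter list set \<Rightarrow> letter list set monoid" where
  "underlying_group M = free_group (fst M) Mod snd M"

lemma topspace_marked_groups:
  "topspace marked_groups = {(k, N). k \<ge> 1 \<and> N \<lhd> free_group k}"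
  by (auto simp: marked_groups_def marked_groups_on_def topspace_pullback_topology)

definition left_orders :: "('a, 'b) monoid_scheme \<Rightarrow> 'a rel set" where
  "left_orders G =
     {R. linear_order_on (carrier G) R \<and>
         (\<forall>g \<in> carrier G. \<forall>h \<in> carrier G. \<forall>k \<in> carrier G.
            (g, h) \<in> R \<longrightarrow> (k \<otimes>\<^bsub>G\<^esub> g, k \<otimes>\<^bsub>G\<^esub> h) \<in> R)}"

definition order_nbhd :: "('a, 'b) monoid_scheme \<Rightarrow> 'a rel \<Rightarrow> 'a set \<Rightarrow> 'a rel set" where
  "order_nbhd G R X =
     {R' \<in> left_orders G. \<forall>x \<in> X. \<forall>y \<in> X. (x, y) \<in> R' \<longleftrightarrow> (x, y) \<in> R}"

definition LO :: "('a, 'b) monoid_scheme \<Rightarrow> 'a rel topology" where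
  "LO G = topology_generated_by
     {order_nbhd G R X | R X. R \<in> left_orders G \<and> finite X \<and> X \<subseteq> carrier G}"

lemma topspace_LO: "topspace (LO G) = left_orders G"
proof -
  have "R \<in> order_nbhd G R {}" if "R \<in> left_orders G" for R
    using that by (simp add: order_nbhd_def)
  then show ?thesis
    unfolding LO_def topology_generated_by_topspace
    by (auto simp: order_nbhd_def)
qed

definition isolated_left_order :: "('a, 'b) monoid_scheme \<Rightarrow> 'a rel \<Rightarrow> bool" where
  "isolated_left_order G R \<longleftrightarrow> R \<in> topspace (LO G) \<and> openin (LO G) {R}"

end

theory Submission
  imports Defs "HOL-Algebra.Multiplicative_Group"
begin

text \<open>
  Both failures are visible on abelian groups, through two convergent sequences of marked groups.

  \<^item> The cyclic groups of order \<open>n + 2\<close>, marked by a generator, converge to the infinite cyclic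
    group. The integers have only two left orders, so both are isolated; a nontrivial finite group
    has no left order at all. Hence the set is not open.

  \<^item> The integers, marked by the pair \<open>(1, n)\<close>, converge to the integer plane marked by its
    standard basis, since \<open>x + n * y = 0\<close> forces \<open>x = y = 0\<close> as soon as \<open>n > \<bar>x\<bar>\<close>.
    No left order of the plane is isolated: given finitely many elements that
    are positive for some order, an integer linear functional is positive on all of them
    (lemma \<open>integer_functional_positive_on_finite\<close>). Its kernel is infinite cyclic, and the two
    ways of ordering this kernel give two different lexicographic orders for which the given
    elements are positive. Hence the set is not closed.

  Both sequences consist of kernels \<open>ker (h\<^sub>n \<circ> f)\<close>, where \<open>f\<close> maps a free group onto a group \<open>H\<close>
  and every nontrivial element of \<open>H\<close> eventually survives under the homomorphisms \<open>h\<^sub>n\<close>; such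
  kernels converge to \<open>ker f\<close> (lemma \<open>limitin_marked_quotient\<close>). As the existence of an isolated
  order is invariant under isomorphism, it can be decided on the images of the homomorphisms
  instead of on quotients of the free group.
\<close>

section \<open>Isolated left orders\<close>

lemma left_ordersD:
  assumes "R \<in> left_orders G"
  shows "R \<subseteq> carrier G \<times> carrier G"
    and "x \<in> carrier G \<Longrightarrow> (x, x) \<in> R"
    and "(x, y) \<in> R \<Longrightarrow> (y, z) \<in> R \<Longrightarrow> (x, z) \<in> R"
    and "(x, y) \<in> R \<Longrightarrow> (y, x) \<in> R \<Longrightarrow> x = y"
    and "x \<in> carrier G \<Longrightarrow> y \<in> carrier G \<Longrightarrow> (x, y) \<in> R \<or> (y, x) \<in> R"
    and "(x, y) \<in> R \<Longrightarrow> k \<in> carrier G \<Longrightarrow> (k \<otimes>\<^bsub>G\<^esub> x, k \<otimes>\<^bsub>G\<^esub> y) \<in> R"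
proof -
  have R: "linear_order_on (carrier G) R"
    and inv: "\<And>g h k. \<lbrakk>g \<in> carrier G; h \<in> carrier G; k \<in> carrier G; (g, h) \<in> R\<rbrakk>
      \<Longrightarrow> (k \<otimes>\<^bsub>G\<^esub> g, k \<otimes>\<^bsub>G\<^esub> h) \<in> R"
    using assms by (auto simp: left_orders_def)
  show sub: "R \<subseteq> carrier G \<times> carrier G" and refl: "x \<in> carrier G \<Longrightarrow> (x, x) \<in> R"
    using R by (auto simp: order_on_defs refl_on_def)
  show "(x, y) \<in> R \<Longrightarrow> (y, z) \<in> R \<Longrightarrow> (x, z) \<in> R"
    using R by (auto simp: order_on_defs elim: transE)
  show "(x, y) \<in> R \<Longrightarrow> (y, x) \<in> R \<Longrightarrow> x = y"
    using R by (auto simp: order_on_defs elim: antisymD)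
  show "x \<in> carrier G \<Longrightarrow> y \<in> carrier G \<Longrightarrow> (x, y) \<in> R \<or> (y, x) \<in> R"
    using R refl by (cases "x = y") (auto simp: order_on_defs total_on_def)
  show "(x, y) \<in> R \<Longrightarrow> k \<in> carrier G \<Longrightarrow> (k \<otimes>\<^bsub>G\<^esub> x, k \<otimes>\<^bsub>G\<^esub> y) \<in> R"
    using inv sub by auto
qed

lemma left_ordersI:
  assumes "R \<subseteq> carrier G \<times> carrier G"
    and "\<And>x. x \<in> carrier G \<Longrightarrow> (x, x) \<in> R"
    and "\<And>x y z. (x, y) \<in> R \<Longrightarrow> (y, z) \<in> R \<Longrightarrow> (x, z) \<in> R"
    and "\<And>x y. (x, y) \<in> R \<Longrightarrow> (y, x) \<in> R \<Longrightarrow> x = y"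
    and "\<And>x y. x \<in> carrier G \<Longrightarrow> y \<in> carrier G \<Longrightarrow> (x, y) \<in> R \<or> (y, x) \<in> R"
    and "\<And>x y k. (x, y) \<in> R \<Longrightarrow> k \<in> carrier G \<Longrightarrow> (k \<otimes>\<^bsub>G\<^esub> x, k \<otimes>\<^bsub>G\<^esub> y) \<in> R"
  shows "R \<in> left_orders G"
proof -
  have "refl_on (carrier G) R" "trans R" "antisym R" "total_on (carrier G) R"
    using assms(2,5) by (auto simp: refl_on_def total_on_def intro: transI antisymI assms(3,4))
  then show ?thesis
    using assms(1,6) by (simp add: left_orders_def order_on_defs)
qed

text \<open>The sets \<open>order_nbhd G R X\<close> around a fixed \<open>R\<close> are closed under finite intersection
  (take the union of the finite sets), so they form a neighbourhood base and not just a
  subbase.\<close>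

lemma isolated_left_order_iff:
  "isolated_left_order G R \<longleftrightarrow>
     R \<in> left_orders G \<and> (\<exists>X. finite X \<and> X \<subseteq> carrier G \<and> order_nbhd G R X = {R})"
proof -
  let ?B = "{order_nbhd G R X | R X. R \<in> left_orders G \<and> finite X \<and> X \<subseteq> carrier G}"
  have base: "\<exists>X. finite X \<and> X \<subseteq> carrier G \<and> order_nbhd G R X \<subseteq> U"
    if "generate_topology_on ?B U" "R \<in> U" for U
    using that
  proof (induction rule: generate_topology_on.induct)
    case (Int U V)
    then obtain X Y where X: "finite X" "X \<subseteq> carrier G" "order_nbhd G R X \<subseteq> U"
      and Y: "finite Y" "Y \<subseteq> carrier G" "order_nbhd G R Y \<subseteq> V"
      by blast
    have "order_nbhd G R (X \<union> Y) \<subseteq> order_nbhd G R X \<inter> order_nbhd G R Y"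
      by (auto simp: order_nbhd_def)
    also have "\<dots> \<subseteq> U \<inter> V"
      using X(3) Y(3) by (rule Int_mono)
    finally show ?case
      using X(1,2) Y(1,2) by (intro exI[of _ "X \<union> Y"]) simp
  next
    case (UN K)
    then obtain k where "k \<in> K" "R \<in> k" by (elim UnionE)
    with UN.IH show ?case by (metis Union_upper subset_trans)
  next
    case (Basis U)
    then obtain R' X where "U = order_nbhd G R' X" "finite X" "X \<subseteq> carrier G"
      by auto
    moreover from this Basis have "order_nbhd G R X \<subseteq> order_nbhd G R' X"
      by (auto simp: order_nbhd_def)
    ultimately show ?case by blast
  qed simp
  have "openin (LO G) {R} \<longleftrightarrow> (\<exists>X. finite X \<and> X \<subseteq> carrier G \<and> order_nbhd G R X = {R})"
    if R: "R \<in> left_orders G"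
  proof
    assume "openin (LO G) {R}"
    then have "\<exists>X. finite X \<and> X \<subseteq> carrier G \<and> order_nbhd G R X \<subseteq> {R}"
      by (intro base) (simp_all add: LO_def openin_topology_generated_by_iff)
    moreover have "R \<in> order_nbhd G R X" for X
      using R by (simp add: order_nbhd_def)
    ultimately show "\<exists>X. finite X \<and> X \<subseteq> carrier G \<and> order_nbhd G R X = {R}"
      by blast
  next
    assume "\<exists>X. finite X \<and> X \<subseteq> carrier G \<and> order_nbhd G R X = {R}"
    then obtain X where X: "finite X" "X \<subseteq> carrier G" "order_nbhd G R X = {R}"
      by blast
    have "openin (LO G) (order_nbhd G R X)"
      unfolding LO_def using R X(1,2) by (intro topology_generated_by_Basis) blast
    then show "openin (LO G) {R}"
      by (simp only: X(3))
  qed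
  then show ?thesis
    by (auto simp: isolated_left_order_def topspace_LO)
qed

text \<open>Between total orders, one inclusion already gives equality.\<close>

lemma left_orders_agreeI:
  assumes "R \<in> left_orders G" "R' \<in> left_orders G" "X \<subseteq> carrier G"
    and "\<And>x y. x \<in> X \<Longrightarrow> y \<in> X \<Longrightarrow> (x, y) \<in> R \<Longrightarrow> (x, y) \<in> R'"
    and "x \<in> X" "y \<in> X"
  shows "(x, y) \<in> R' \<longleftrightarrow> (x, y) \<in> R"
proof
  assume R': "(x, y) \<in> R'"
  show "(x, y) \<in> R"
  proof (rule ccontr)
    assume "(x, y) \<notin> R"
    with assms(3,5,6) left_ordersD(5)[OF assms(1), of x y] have R: "(y, x) \<in> R"
      by auto
    then have "x = y"
      using left_ordersD(4)[OF assms(2) R'] assms(4-6) by simp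
    with R \<open>(x, y) \<notin> R\<close> show False by simp
  qed
qed (rule assms(4)[OF assms(5,6)])

definition pullback_order :: "('a, 'b) monoid_scheme \<Rightarrow> ('a \<Rightarrow> 'c) \<Rightarrow> 'c rel \<Rightarrow> 'a rel" where
  "pullback_order G f R = {(x, y) \<in> carrier G \<times> carrier G. (f x, f y) \<in> R}"

lemma pullback_order_left_orders:
  assumes "group G" and f: "f \<in> iso G H" and R: "R \<in> left_orders H"
  shows "pullback_order G f R \<in> left_orders G"
proof -
  interpret group G by fact
  have inj: "inj_on f (carrier G)" and hom: "f \<in> hom G H"
    using f by (auto simp: iso_def bij_betw_def)
  have mem: "f x \<in> carrier H" if "x \<in> carrier G" for x
    using hom that by (auto simp: hom_def)
  have pullback: "(x, y) \<in> pullback_order G f R \<longleftrightarrow>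
      x \<in> carrier G \<and> y \<in> carrier G \<and> (f x, f y) \<in> R" for x y
    by (simp add: pullback_order_def)
  show ?thesis
  proof (rule left_ordersI)
    show "pullback_order G f R \<subseteq> carrier G \<times> carrier G"
      by (auto simp: pullback_order_def)
  next
    show "(x, z) \<in> pullback_order G f R"
      if "(x, y) \<in> pullback_order G f R" "(y, z) \<in> pullback_order G f R" for x y z
      using that left_ordersD(3)[OF R, of "f x" "f y" "f z"] by (simp add: pullback)
  next
    show "x = y" if "(x, y) \<in> pullback_order G f R" "(y, x) \<in> pullback_order G f R" for x y
      using that left_ordersD(4)[OF R, of "f x" "f y"] inj by (simp add: pullback inj_on_eq_iff)
  next
    show "(k \<otimes>\<^bsub>G\<^esub> x, k \<otimes>\<^bsub>G\<^esub> y) \<in> pullback_order G f R"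
      if "(x, y) \<in> pullback_order G f R" "k \<in> carrier G" for x y k
      using that left_ordersD(6)[OF R, of "f x" "f y" "f k"] mem
      by (simp add: pullback hom_mult[OF hom])
  qed (use left_ordersD(2,5)[OF R] mem in \<open>simp_all add: pullback\<close>)
qed

lemma isolated_left_order_iso:
  assumes G: "group G" and H: "group H" and iso: "G \<cong> H"
    and ex: "\<exists>R. isolated_left_order G R"
  shows "\<exists>R. isolated_left_order H R"
proof -
  obtain f where f: "f \<in> iso G H"
    using iso unfolding is_iso_def by blast
  define g where "g = inv_into (carrier G) f"
  have g: "g \<in> iso H G"
    using group.iso_set_sym[OF G f] by (simp add: g_def)
  have fmem: "f x \<in> carrier H" if "x \<in> carrier G" for x
    using f that unfolding iso_def hom_def by blast
  have gmem: "g y \<in> carrier G" if "y \<in> carrier H" for y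
    using g that unfolding iso_def hom_def by blast
  have gf: "g (f x) = x" if "x \<in> carrier G" for x
    using f that by (simp add: g_def iso_iff)
  have fg: "f (g y) = y" if "y \<in> carrier H" for y
    using f that by (simp add: g_def iso_iff f_inv_into_f)
  obtain R X where R: "R \<in> left_orders G"
    and X: "finite X" "X \<subseteq> carrier G" "order_nbhd G R X = {R}"
    using ex unfolding isolated_left_order_iff by blast
  let ?S = "pullback_order H g R"
  have S: "?S \<in> left_orders H"
    by (rule pullback_order_left_orders[OF H g R])
  have "S' = ?S" if S': "S' \<in> order_nbhd H ?S (f ` X)" for S'
  proof -
    have lo: "S' \<in> left_orders H"
      using S' by (simp add: order_nbhd_def)
    have "pullback_order G f S' \<in> order_nbhd G R X"
      using S' X(2) pullback_order_left_orders[OF G f lo]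
      by (auto simp: order_nbhd_def pullback_order_def gf fmem subset_iff)
    then have "pullback_order G f S' = R"
      using X(3) by simp
    then show "S' = ?S"
      using left_ordersD(1)[OF lo] by (auto simp: pullback_order_def fg gmem)
  qed
  moreover have "?S \<in> order_nbhd H ?S (f ` X)"
    using S by (simp add: order_nbhd_def)
  ultimately have "order_nbhd H ?S (f ` X) = {?S}"
    by blast
  then show ?thesis
    unfolding isolated_left_order_iff using S X(1,2) fmem
    by (intro exI[of _ ?S] conjI exI[of _ "f ` X"]) auto
qed

section \<open>Left orders on finite groups, on the integers and on the integer plane\<close>

text \<open>If \<open>y\<close> is a positive element, then so are \<open>y \<le> y\<^sup>2 \<le> y\<^sup>3 \<le> \<dots>\<close>, and this chain never
  returns to the identity.\<close>

lemma left_orders_finite_group: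
  assumes "group G" "finite (carrier G)" and x: "x \<in> carrier G" "x \<noteq> \<one>\<^bsub>G\<^esub>"
  shows "left_orders G = {}"
proof -
  interpret group G by fact
  have pos: False
    if R: "R \<in> left_orders G" and y: "y \<in> carrier G" "y \<noteq> \<one>\<^bsub>G\<^esub>" "(\<one>\<^bsub>G\<^esub>, y) \<in> R" for R y
  proof -
    have "(y, y [^]\<^bsub>G\<^esub> Suc n) \<in> R" for n
    proof (induction n)
      case 0
      then show ?case using left_ordersD(2)[OF R y(1)] y(1) by simp
    next
      case (Suc n)
      have "(y [^]\<^bsub>G\<^esub> Suc n \<otimes>\<^bsub>G\<^esub> \<one>\<^bsub>G\<^esub>, y [^]\<^bsub>G\<^esub> Suc n \<otimes>\<^bsub>G\<^esub> y) \<in> R"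
        by (intro left_ordersD(6)[OF R y(3)] nat_pow_closed y(1))
      then have "(y [^]\<^bsub>G\<^esub> Suc n, y [^]\<^bsub>G\<^esub> Suc (Suc n)) \<in> R"
        using y(1) by simp
      with Suc show ?case
        by (rule left_ordersD(3)[OF R])
    qed
    moreover have "order G > 0"
      using assms(2) by (simp add: order_gt_0_iff_finite)
    ultimately have "(y, y [^]\<^bsub>G\<^esub> order G) \<in> R"
      by (metis Suc_pred)
    then show False
      using y left_ordersD(4)[OF R] pow_order_eq_1[OF y(1)] by metis
  qed
  have False if R: "R \<in> left_orders G" for R
  proof (cases "(\<one>\<^bsub>G\<^esub>, x) \<in> R")
    case True
    then show False using pos[OF R x] by blast
  next
    case False
    then have "(x, \<one>\<^bsub>G\<^esub>) \<in> R"
      using left_ordersD(5)[OF R x(1) one_closed] by blast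
    from left_ordersD(6)[OF R this inv_closed[OF x(1)]] have "(\<one>\<^bsub>G\<^esub>, inv\<^bsub>G\<^esub> x) \<in> R"
      using x(1) by simp
    then show False
      using pos[OF R inv_closed[OF x(1)]] x inv_eq_1_iff by blast
  qed
  then show ?thesis by blast
qed

text \<open>The usual order is the only left order with \<open>0 < 1\<close>, so two points suffice to isolate it.\<close>

lemma isolated_left_order_integer_group: "\<exists>R. isolated_left_order integer_group R"
proof -
  let ?R = "{(x, y). x \<le> (y :: int)}"
  have R: "?R \<in> left_orders integer_group"
    by (rule left_ordersI) auto
  have "R' = ?R" if "R' \<in> order_nbhd integer_group ?R {0, 1}" for R'
  proof -
    have R': "R' \<in> left_orders integer_group" and pos: "(0, 1) \<in> R'"
      using that by (auto simp: order_nbhd_def)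
    have succ: "(x, x + 1) \<in> R'" for x
      using left_ordersD(6)[OF R' pos, of x] by simp
    have "(x, y) \<in> R'" if "x \<le> y" for x y
      using that
    proof (induction y rule: int_ge_induct)
      case base
      then show ?case using left_ordersD(2)[OF R'] by simp
    next
      case (step y)
      then show ?case using left_ordersD(3)[OF R'] succ by blast
    qed
    then have "(x, y) \<in> R' \<longleftrightarrow> (x, y) \<in> ?R" for x y
      by (intro left_orders_agreeI[OF R R', of UNIV]) auto
    then show ?thesis unfolding set_eq_iff split_paired_All by blast
  qed
  moreover have "?R \<in> order_nbhd integer_group ?R {0, 1}"
    using R by (simp add: order_nbhd_def)
  ultimately have "order_nbhd integer_group ?R {0, 1} = {?R}"
    by blast
  with R show ?thesis
    unfolding isolated_left_order_iff by (intro exI[of _ ?R] conjI exI[of _ "{0, 1}"]) auto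
qed

text \<open>Geometrically: finitely many points of a cone in the plane without opposite directions lie in
  an open half plane. For the induction, let \<open>L\<close> be a functional that is positive on \<open>S\<close> but not
  at the new point \<open>p\<close>. Then \<open>S\<close> lies strictly on one side of the line through \<open>0\<close> and \<open>p\<close>: a
  point of \<open>S\<close> on this line, or two points on opposite sides of it, would yield together with
  \<open>L p \<le> 0\<close> a positive combination of elements of \<open>P\<close> that vanishes. So one of the functionals
  \<open>u \<mapsto> \<plusminus> det (p, u)\<close> is positive on \<open>S\<close>. It vanishes at \<open>p\<close>, and adding the inner product
  with \<open>p\<close> to a large multiple of it makes it positive there as well.\<close>

lemma integer_functional_positive_on_finite:
  fixes P :: "(int \<times> int) set"
  assumes add: "\<And>u v. u \<in> P \<Longrightarrow> v \<in> P \<Longrightarrow> u + v \<in> P" and zero: "0 \<notin> P"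
    and "finite S" "S \<subseteq> P"
  shows "\<exists>a b. \<forall>(x, y) \<in> S. a * x + b * y > 0"
  using assms(3,4)
proof (induction S rule: finite_induct)
  case (insert p S)
  define scale :: "int \<Rightarrow> int \<times> int \<Rightarrow> int \<times> int" where "scale n u = (n * fst u, n * snd u)" for n u
  have scale: "scale n u \<in> P" if "u \<in> P" "n > 0" for n u
    using that(2)
  proof (induction n rule: int_gr_induct)
    case base
    then show ?case using that(1) by (simp add: scale_def)
  next
    case (step n)
    moreover have "scale (n + 1) u = scale n u + u"
      by (simp add: scale_def prod_eq_iff algebra_simps)
    ultimately show ?case using add that(1) by simp
  qed
  obtain a b where ab: "\<And>x y. (x, y) \<in> S \<Longrightarrow> a * x + b * y > 0"
    using insert by blast
  obtain p1 p2 where p: "p = (p1, p2)" by (cases p)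
  have pP: "(p1, p2) \<in> P" and SP: "S \<subseteq> P"
    using insert.prems p by auto
  show ?case
  proof (cases "a * p1 + b * p2 > 0")
    case True
    then show ?thesis using ab p by (intro exI[of _ a] exI[of _ b]) auto
  next
    case False
    define D where "D x y = p1 * y - p2 * x" for x y
    define E where "E x y = p1 * x + p2 * y" for x y
    have Epp: "E p1 p2 > 0"
    proof -
      have "p1 \<noteq> 0 \<or> p2 \<noteq> 0"
        using pP zero by (auto simp: zero_prod_def)
      then show ?thesis
        by (auto simp: E_def sum_squares_gt_zero_iff)
    qed
    have D_nonzero: "D x y \<noteq> 0" if s: "(x, y) \<in> S" for x y
    proof
      assume D0: "D x y = 0"
      \<comment> \<open>As \<open>(x, y)\<close> is parallel to \<open>p\<close>, it must be a negative multiple of \<open>p\<close>.\<close>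
      have "E p1 p2 * (a * x + b * y) = E x y * (a * p1 + b * p2) + D x y * (b * p1 - a * p2)"
        by (simp add: D_def E_def algebra_simps)
      then have "E x y * (a * p1 + b * p2) > 0"
        using D0 Epp ab[OF s] by (metis add.right_neutral mult_pos_pos mult_zero_left)
      then have "E x y < 0"
        using False by (auto simp: zero_less_mult_iff)
      then have "scale (E p1 p2) (x, y) + scale (- E x y) (p1, p2) \<in> P"
        using s SP pP Epp by (intro add scale) auto
      moreover have "scale (E p1 p2) (x, y) + scale (- E x y) (p1, p2)
          = (- p2 * D x y, p1 * D x y)"
        by (simp add: scale_def D_def E_def algebra_simps)
      ultimately show False
        using zero D0 by (simp add: zero_prod_def)
    qed
    have same_side: "\<not> D t1 t2 < 0"
      if s: "(s1, s2) \<in> S" "D s1 s2 > 0" and t: "(t1, t2) \<in> S" for s1 s2 t1 t2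
    proof
      assume neg: "D t1 t2 < 0"
      \<comment> \<open>Three vectors \<open>p, s, t\<close> of the plane satisfy
        \<open>det (s, t) p + det (t, p) s + det (p, s) t = 0\<close>. The last two coefficients are positive;
        applying the old functional shows that so is the first.\<close>
      define c where "c = s1 * t2 - s2 * t1"
      have "D s1 s2 * (a * t1 + b * t2) + (- D t1 t2) * (a * s1 + b * s2)
          = - (c * (a * p1 + b * p2))"
        by (simp add: D_def c_def algebra_simps)
      moreover have "D s1 s2 * (a * t1 + b * t2) + (- D t1 t2) * (a * s1 + b * s2) > 0"
        using neg by (intro add_pos_pos[OF mult_pos_pos[OF s(2) ab[OF t]]
              mult_pos_pos[OF _ ab[OF s(1)]]]) simp
      ultimately have "c * (a * p1 + b * p2) < 0"
        by linarith
      then have "c > 0"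
        using False by (auto simp: mult_less_0_iff)
      then have "scale (D s1 s2) (t1, t2) + scale (- D t1 t2) (s1, s2) + scale c (p1, p2) \<in> P"
        using s t neg SP pP by (intro add scale) auto
      moreover have
        "scale (D s1 s2) (t1, t2) + scale (- D t1 t2) (s1, s2) + scale c (p1, p2) = 0"
        by (simp add: scale_def D_def c_def zero_prod_def algebra_simps)
      ultimately show False
        using zero by metis
    qed
    have "\<exists>\<epsilon>. \<forall>(x, y) \<in> S. \<epsilon> * D x y > 0"
    proof (cases "\<exists>(x, y) \<in> S. D x y > 0")
      case True
      then obtain s1 s2 where "(s1, s2) \<in> S" "D s1 s2 > 0" by blast
      then have "1 * D x y > 0" if "(x, y) \<in> S" for x y
        using same_side[of s1 s2 x y] D_nonzero[OF that] that by (simp add: not_less)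
      then show ?thesis by (intro exI[of _ 1]) blast
    next
      case False
      then have "(- 1) * D x y > 0" if "(x, y) \<in> S" for x y
        using D_nonzero[OF that] that by force
      then show ?thesis by (intro exI[of _ "- 1"]) blast
    qed
    then obtain \<epsilon> where \<epsilon>: "\<And>x y. (x, y) \<in> S \<Longrightarrow> \<epsilon> * D x y > 0" by blast
    \<comment> \<open>Since \<open>\<epsilon> * D x y \<ge> 1\<close> on \<open>S\<close>, this multiple of \<open>D\<close> dominates \<open>E\<close> there.\<close>
    define K where "K = (1 + (\<Sum>u \<in> S. \<bar>E (fst u) (snd u)\<bar>)) * \<epsilon>"
    have "K * D x y + E x y > 0" if s: "(x, y) \<in> S" for x y
    proof -
      have "\<bar>E x y\<bar> \<le> (\<Sum>u \<in> S. \<bar>E (fst u) (snd u)\<bar>)"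
        using member_le_sum[of "(x, y)" S "\<lambda>u. \<bar>E (fst u) (snd u)\<bar>"] s insert.hyps by simp
      moreover have "K * D x y \<ge> 1 + (\<Sum>u \<in> S. \<bar>E (fst u) (snd u)\<bar>)"
        using mult_left_mono[of 1 "\<epsilon> * D x y" "1 + (\<Sum>u \<in> S. \<bar>E (fst u) (snd u)\<bar>)"] \<epsilon>[OF s]
          sum_nonneg[of S "\<lambda>u. \<bar>E (fst u) (snd u)\<bar>"]
        by (simp add: K_def mult.assoc)
      ultimately show ?thesis by linarith
    qed
    moreover have "K * D p1 p2 + E p1 p2 > 0"
      using Epp by (simp add: D_def)
    ultimately show ?thesis
      using p by (intro exI[of _ "p1 - K * p2"] exI[of _ "p2 + K * p1"])
        (auto simp: D_def E_def algebra_simps)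
  qed
qed simp

abbreviation integer_plane :: "(int \<times> int) monoid" where
  "integer_plane \<equiv> integer_group \<times>\<times> integer_group"

lemma mult_integer_plane: "u \<otimes>\<^bsub>integer_plane\<^esub> v = u + v"
  by (cases u; cases v) simp

lemma lexicographic_left_order:
  fixes L M :: "int \<times> int \<Rightarrow> int"
  assumes L: "\<And>u v. L (u + v) = L u + L v" and M: "\<And>u v. M (u + v) = M u + M v"
    and inj: "\<And>u v. L u = L v \<Longrightarrow> M u = M v \<Longrightarrow> u = v"
  shows "{(u, v). L u < L v \<or> L u = L v \<and> M u \<le> M v} \<in> left_orders integer_plane"
proof (rule left_ordersI)
  fix u v
  assume "(u, v) \<in> {(u, v). L u < L v \<or> L u = L v \<and> M u \<le> M v}"
    and "(v, u) \<in> {(u, v). L u < L v \<or> L u = L v \<and> M u \<le> M v}"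
  then show "u = v"
    by (intro inj) auto
qed (auto simp: mult_integer_plane L M)

lemma int_pow_integer_plane: "u [^]\<^bsub>integer_plane\<^esub> (n :: int) = (n * fst u, n * snd u)"
proof -
  have plane: "group integer_plane"
    by (simp add: DirProd_group)
  have "fst \<in> hom integer_plane integer_group" "snd \<in> hom integer_plane integer_group"
    by (auto intro!: homI)
  then show ?thesis
    using hom_int_pow[of fst integer_plane integer_group u n]
      hom_int_pow[of snd integer_plane integer_group u n] plane
    by (simp add: prod_eq_iff mem_Times_iff)
qed

text \<open>Agreement with \<open>R\<close> on \<open>X\<close> only says that the differences \<open>v - u\<close> with \<open>u\<close> strictly below \<open>v\<close> in \<open>X\<close> are
  positive. A functional \<open>L\<close> that is positive on these leaves two choices for the order on its
  kernel, so at least two orders agree with \<open>R\<close> on \<open>X\<close>.\<close>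

lemma no_isolated_left_order_integer_plane: "\<not> isolated_left_order integer_plane R"
proof
  assume "isolated_left_order integer_plane R"
  then obtain X where R: "R \<in> left_orders integer_plane"
    and X: "finite X" "order_nbhd integer_plane R X = {R}"
    by (auto simp: isolated_left_order_iff)
  define P where "P = {u. u \<noteq> 0 \<and> (0, u) \<in> R}"
  have shift: "(w + u, w + v) \<in> R" if "(u, v) \<in> R" for u v w
    using left_ordersD(6)[OF R that, of w] by (simp add: mult_integer_plane)
  have diff: "v - u \<in> P" if "(u, v) \<in> R" "u \<noteq> v" for u v
    using shift[OF that(1), of "- u"] that(2) by (simp add: P_def)
  have P_add: "u + v \<in> P" if "u \<in> P" "v \<in> P" for u v
  proof -
    have u: "(0, u) \<in> R" "(u, u + v) \<in> R" "u \<noteq> 0"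
      using that shift[of 0 v u] by (simp_all add: P_def)
    then have "u + v \<noteq> 0"
      using left_ordersD(4)[OF R u(1)] by metis
    then show ?thesis
      using left_ordersD(3)[OF R u(1,2)] by (simp add: P_def)
  qed
  obtain q where q: "q \<in> P"
  proof (cases "(0, (1, 0)) \<in> R")
    case True
    then show ?thesis using that[of "(1, 0)"] by (simp add: P_def zero_prod_def)
  next
    case False
    then have "((1, 0), 0) \<in> R"
      using left_ordersD(5)[OF R, of 0 "(1, 0)"] by simp
    then show ?thesis using that diff by (fastforce simp: zero_prod_def)
  qed
  \<comment> \<open>Including \<open>q\<close> forces the functional to be nonzero even if there are no differences.\<close>
  define S where "S = insert q ((\<lambda>(u, v). v - u) ` {(u, v) \<in> X \<times> X. (u, v) \<in> R \<and> u \<noteq> v})"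
  have "finite {(u, v) \<in> X \<times> X. (u, v) \<in> R \<and> u \<noteq> v}"
    by (rule finite_subset[of _ "X \<times> X"]) (use X(1) in auto)
  then have "finite S"
    by (simp add: S_def)
  moreover have "(\<lambda>(u, v). v - u) ` {(u, v) \<in> X \<times> X. (u, v) \<in> R \<and> u \<noteq> v} \<subseteq> P"
    using diff by (intro image_subsetI) (simp add: case_prod_beta)
  then have "S \<subseteq> P"
    using q by (simp add: S_def)
  ultimately have "\<exists>a b. \<forall>(x, y) \<in> S. a * x + b * y > 0"
    by (intro integer_functional_positive_on_finite[where P = P] P_add) (auto simp: P_def)
  then obtain a b where ab: "\<And>x y. (x, y) \<in> S \<Longrightarrow> a * x + b * y > 0"
    by blast
  define L where "L u = a * fst u + b * snd u" for u
  have L_pos: "L w > 0" if "w \<in> S" for w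
    using ab[of "fst w" "snd w"] that by (simp add: L_def)
  \<comment> \<open>\<open>M\<close> is injective on the kernel of \<open>L\<close>, which is spanned over the rationals by
    \<open>(- b, a)\<close>; the sign of \<open>\<epsilon>\<close> chooses the order on this kernel.\<close>
  define M where "M u = - b * fst u + a * snd u" for u
  define lex where "lex \<epsilon> = {(u, v). L u < L v \<or> L u = L v \<and> \<epsilon> * M u \<le> \<epsilon> * M v}" for \<epsilon> :: int
  have nz: "a \<noteq> 0 \<or> b \<noteq> 0"
    using ab[of "fst q" "snd q"] by (auto simp: S_def)
  then have norm: "a * a + b * b > 0"
    by (auto simp: sum_squares_gt_zero_iff)
  have inj: "u = v" if "L u = L v" "M u = M v" for u v
  proof -
    have "(a * a + b * b) * fst w = a * L w - b * M w"
      "(a * a + b * b) * snd w = b * L w + a * M w" for w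
      by (simp_all add: L_def M_def algebra_simps)
    then show ?thesis
      using that norm by (metis mult_cancel_left order_less_irrefl prod_eqI)
  qed
  have "lex \<epsilon> = R" if "\<epsilon> \<noteq> 0" for \<epsilon>
  proof -
    have lo: "lex \<epsilon> \<in> left_orders integer_plane"
      unfolding lex_def
    proof (rule lexicographic_left_order)
      show "u = v" if "L u = L v" "\<epsilon> * M u = \<epsilon> * M v" for u v
        using that \<open>\<epsilon> \<noteq> 0\<close> by (intro inj) simp_all
    qed (simp_all add: L_def M_def algebra_simps)
    have "(u, v) \<in> lex \<epsilon>" if uv: "u \<in> X" "v \<in> X" "(u, v) \<in> R" for u v
    proof (cases "u = v")
      case False
      then have "v - u \<in> S"
        using uv by (force simp: S_def)
      then have "L (v - u) > 0"
        by (rule L_pos)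
      then show ?thesis
        by (simp add: lex_def L_def algebra_simps)
    qed (simp add: lex_def)
    then have "lex \<epsilon> \<in> order_nbhd integer_plane R X"
      using lo left_orders_agreeI[OF R lo, of X] by (simp add: order_nbhd_def)
    then show ?thesis
      using X(2) by simp
  qed
  then have "lex 1 = lex (- 1)"
    by simp
  moreover have "(0, (- b, a)) \<in> lex 1" "(0, (- b, a)) \<notin> lex (- 1)"
    using norm by (auto simp: lex_def L_def M_def algebra_simps)
  ultimately show False
    by simp
qed

section \<open>Limits of marked quotients of a free group\<close>

text \<open>Convergence of marked groups is pointwise: each word must eventually be a relation exactly
  when it is one in the limit.\<close>

lemma limitin_marked_groups:
  assumes k: "k \<ge> 1" and N: "N \<lhd> free_group k" and Nn: "\<And>n. Nn n \<lhd> free_group k"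
    and ev: "\<And>w. w \<in> carrier (free_group k) \<Longrightarrow> \<forall>\<^sub>F n in F. w \<in> Nn n \<longleftrightarrow> w \<in> N"
  shows "limitin marked_groups (\<lambda>n. (k, Nn n)) (k, N) F"
  unfolding limitin_def
proof (intro conjI allI impI)
  show "(k, N) \<in> topspace marked_groups"
    using k N by (simp add: topspace_marked_groups)
  fix U
  assume U: "openin marked_groups U \<and> (k, N) \<in> U"
  let ?ind = "\<lambda>N. \<lambda>x \<in> carrier (free_group k). x \<in> N"
  let ?T = "product_topology (\<lambda>_. discrete_topology (UNIV :: bool set)) (carrier (free_group k))"
  have "openin (marked_groups_on k) {N. (k, N) \<in> U}"
    using U k by (simp add: marked_groups_def openin_sum_topology)
  then obtain V where V: "openin ?T V"
    and UV: "{N. (k, N) \<in> U} = ?ind -` V \<inter> {N. N \<lhd> free_group k}"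
    by (auto simp: marked_groups_on_def openin_pullback_topology)
  have "limitin (discrete_topology UNIV) (\<lambda>n. ?ind (Nn n) w) (?ind N w) F"
    if "w \<in> carrier (free_group k)" for w
    using ev[OF that] that by (auto simp: limitin_def elim!: eventually_mono)
  then have "limitin ?T (\<lambda>n. ?ind (Nn n)) (?ind N) F"
    unfolding limitin_componentwise by simp
  moreover have "?ind N \<in> V"
    using U UV by blast
  ultimately have "\<forall>\<^sub>F n in F. ?ind (Nn n) \<in> V"
    using V by (simp add: limitin_def)
  then show "\<forall>\<^sub>F n in F. (k, Nn n) \<in> U"
    using UV Nn by (auto elim!: eventually_mono)
qed

text \<open>If \<open>f\<close> is onto, this is the group \<open>H\<close> marked by the images of the free generators,
  represented as a point of the space of marked groups by its set of relations.\<close>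

definition marked_quotient :: "nat \<Rightarrow> ('a, 'b) monoid_scheme \<Rightarrow> (letter list \<Rightarrow> 'a)
    \<Rightarrow> nat \<times> letter list set" where
  "marked_quotient k H f = (k, kernel (free_group k) H f)"

lemma group_hom_free_group: "group H \<Longrightarrow> f \<in> hom (free_group k) H \<Longrightarrow> group_hom (free_group k) H f"
  by (simp add: group_hom_def group_hom_axioms_def group_free_group)

lemma marked_quotient_in_topspace:
  assumes "group H" "f \<in> hom (free_group k) H" "k \<ge> 1"
  shows "marked_quotient k H f \<in> topspace marked_groups"
  using group_hom.normal_kernel[OF group_hom_free_group[OF assms(1,2)]] assms(3)
  by (simp add: topspace_marked_groups marked_quotient_def)

lemma isolated_left_order_marked_quotient:
  assumes H: "group H" and f: "f \<in> hom (free_group k) H"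
    and surj: "f ` carrier (free_group k) = carrier H"
  shows "(\<exists>R. isolated_left_order (underlying_group (marked_quotient k H f)) R)
    \<longleftrightarrow> (\<exists>R. isolated_left_order H R)"
proof -
  interpret group_hom "free_group k" H f
    by (rule group_hom_free_group[OF H f])
  let ?Q = "underlying_group (marked_quotient k H f)"
  have Q: "group ?Q"
    by (simp add: underlying_group_def marked_quotient_def normal.factorgroup_is_group normal_kernel)
  have "?Q \<cong> H"
    using FactGroup_iso[OF surj] by (simp add: underlying_group_def marked_quotient_def)
  then show ?thesis
    using isolated_left_order_iso[OF Q H] isolated_left_order_iso[OF H Q]
      group.iso_sym[OF Q] by blast
qed

text \<open>A word with trivial image in \<open>H\<close> stays trivial under every \<open>h n\<close>, and a word with nontrivial
  image is eventually not killed: the relations of the quotients converge to those of \<open>H\<close>.\<close>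

lemma limitin_marked_quotient:
  assumes k: "k \<ge> 1" and H: "group H" and f: "f \<in> hom (free_group k) H"
    and Hn: "\<And>n. group (Hn n)" and hn: "\<And>n. h n \<in> hom H (Hn n)"
    and ev: "\<And>x. x \<in> carrier H \<Longrightarrow> x \<noteq> \<one>\<^bsub>H\<^esub> \<Longrightarrow> \<forall>\<^sub>F n in F. h n x \<noteq> \<one>\<^bsub>Hn n\<^esub>"
  shows "limitin marked_groups (\<lambda>n. marked_quotient k (Hn n) (h n \<circ> f)) (marked_quotient k H f) F"
  unfolding marked_quotient_def
proof (rule limitin_marked_groups[OF k])
  interpret f: group_hom "free_group k" H f
    by (rule group_hom_free_group[OF H f])
  show "kernel (free_group k) H f \<lhd> free_group k"
    by (rule f.normal_kernel)
  show "kernel (free_group k) (Hn n) (h n \<circ> f) \<lhd> free_group k" for n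
    by (intro group_hom.normal_kernel group_hom_free_group Hn hom_compose[OF f hn])
  fix w assume w: "w \<in> carrier (free_group k)"
  show "\<forall>\<^sub>F n in F. w \<in> kernel (free_group k) (Hn n) (h n \<circ> f) \<longleftrightarrow> w \<in> kernel (free_group k) H f"
  proof (cases "f w = \<one>\<^bsub>H\<^esub>")
    case True
    then show ?thesis
      using w hom_one[OF hn H Hn] by (simp add: kernel_def)
  next
    case False
    then show ?thesis
      using ev[OF f.hom_closed[OF w] False] w by (auto simp: kernel_def elim!: eventually_mono)
  qed
qed

section \<open>The two limits\<close>

theorem corollary1p2:
  shows "\<not> closedin marked_groups
             {M \<in> topspace marked_groups. \<exists>R. isolated_left_order (underlying_group M) R} \<and>
         \<not> openin marked_groups
             {M \<in> topspace marked_groups. \<exists>R. isolated_left_order (underlying_group M) R}"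
    (is "\<not> closedin _ ?I \<and> \<not> openin _ ?I")
proof
  obtain f where f: "f \<in> hom (free_group 2) integer_plane"
    and f_gen: "f [(0, True)] = (1, 0)" "f [(1, True)] = (0, 1)"
    using free_group_universal[of integer_plane 2 "\<lambda>i. if i = 0 then (1, 0) else (0, 1)"]
    by (auto simp: DirProd_group)
  have plane: "group integer_plane"
    by (simp add: DirProd_group)
  interpret f: group_hom "free_group 2" integer_plane f
    by (rule group_hom_free_group[OF plane f])
  have surj_f: "\<exists>w \<in> carrier (free_group 2). f w = (a, b)" for a b
  proof -
    let ?x = "[(0, True)]" and ?y = "[(1, True)]"
    have xy: "?x \<in> carrier (free_group 2)" "?y \<in> carrier (free_group 2)"
      by (simp_all add: generator_in_free_group)
    have "f (?x [^]\<^bsub>free_group 2\<^esub> a \<otimes>\<^bsub>free_group 2\<^esub> ?y [^]\<^bsub>free_group 2\<^esub> b) = (a, b)"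
      using xy by (simp add: f.hom_int_pow f_gen int_pow_integer_plane del: One_nat_def)
    then show ?thesis
      using xy by (meson f.G.int_pow_closed f.G.m_closed)
  qed
  \<comment> \<open>The integers with the marking \<open>(1, n)\<close>, as quotients of the plane.\<close>
  define h :: "nat \<Rightarrow> int \<times> int \<Rightarrow> int" where "h n u = fst u + int n * snd u" for n u
  have h: "h n \<in> hom integer_plane integer_group" for n
    by (rule homI) (auto simp: h_def algebra_simps)
  have lim: "limitin marked_groups (\<lambda>n. marked_quotient 2 integer_group (h n \<circ> f))
      (marked_quotient 2 integer_plane f) sequentially"
  proof (rule limitin_marked_quotient[OF _ plane f _ h])
    fix u :: "int \<times> int" assume u: "u \<noteq> \<one>\<^bsub>integer_plane\<^esub>"
    have "h n u \<noteq> 0" if n: "int n > \<bar>fst u\<bar>" for n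
    proof
      assume 0: "h n u = 0"
      then have "int n dvd fst u"
        by (auto simp: h_def eq_neg_iff_add_eq_0[symmetric])
      then have "fst u = 0"
        using n dvd_imp_le_int[of "fst u" "int n"] by force
      with 0 u n show False
        by (cases u) (simp add: h_def)
    qed
    then show "\<forall>\<^sub>F n in sequentially. h n u \<noteq> \<one>\<^bsub>integer_group\<^esub>"
      unfolding eventually_sequentially by (intro exI[of _ "nat \<bar>fst u\<bar> + 1"]) simp
  qed simp_all
  show "\<not> closedin marked_groups ?I"
  proof
    assume cl: "closedin marked_groups ?I"
    have "marked_quotient 2 integer_group (h n \<circ> f) \<in> ?I" for n
    proof -
      have hom: "h n \<circ> f \<in> hom (free_group 2) integer_group"
        by (rule hom_compose[OF f h])
      have "z \<in> (h n \<circ> f) ` carrier (free_group 2)" for z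
        using surj_f[of z 0] by (force simp: h_def)
      then have "(h n \<circ> f) ` carrier (free_group 2) = carrier integer_group"
        by auto
      then show ?thesis
        using isolated_left_order_marked_quotient[OF group_integer_group hom]
          isolated_left_order_integer_group marked_quotient_in_topspace[OF group_integer_group hom]
        by simp
    qed
    then have "marked_quotient 2 integer_plane f \<in> ?I"
      by (intro limitin_closedin[OF lim cl]) simp_all
    moreover have "u \<in> f ` carrier (free_group 2)" for u
      using surj_f[of "fst u" "snd u"] by (metis image_eqI prod.collapse)
    then have "f ` carrier (free_group 2) = carrier integer_plane"
      by (simp add: set_eq_iff)
    ultimately show False
      using isolated_left_order_marked_quotient[OF plane f] no_isolated_left_order_integer_plane
      by simp
  qed
next
  obtain f where f: "f \<in> hom (free_group 1) integer_group" and f_gen: "f [(0, True)] = 1"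
    using free_group_universal[of integer_group 1 "\<lambda>_. 1"] by auto
  interpret f: group_hom "free_group 1" integer_group f
    by (rule group_hom_free_group[OF group_integer_group f])
  have surj_f: "f ` carrier (free_group 1) = UNIV"
  proof -
    have x: "[(0, True)] \<in> carrier (free_group 1)"
      by (simp add: generator_in_free_group)
    have "f ([(0, True)] [^]\<^bsub>free_group 1\<^esub> a) = a" for a :: int
      using x by (simp add: f.hom_int_pow f_gen del: One_nat_def)
    then show ?thesis
      using x by (metis (no_types, lifting) UNIV_eq_I f.G.int_pow_closed image_eqI)
  qed
  \<comment> \<open>The shift by 2 keeps the trivial group, which has an isolated order, and the integers, which
    are \<open>integer_mod_group 0\<close>, out of the sequence.\<close>
  define h :: "nat \<Rightarrow> int \<Rightarrow> int" where "h n x = x mod int (n + 2)" for n x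
  have h: "h n \<in> hom integer_group (integer_mod_group (n + 2))" for n
    by (rule homI) (auto simp: h_def carrier_integer_mod_group mod_simps)
  have lim: "limitin marked_groups (\<lambda>n. marked_quotient 1 (integer_mod_group (n + 2)) (h n \<circ> f))
      (marked_quotient 1 integer_group f) sequentially"
  proof (rule limitin_marked_quotient[OF _ group_integer_group f _ h])
    fix x :: int assume x: "x \<noteq> \<one>\<^bsub>integer_group\<^esub>"
    have "h n x \<noteq> 0" if n: "int n > \<bar>x\<bar>" for n
    proof
      assume "h n x = 0"
      then have "int (n + 2) dvd x"
        by (auto simp: h_def)
      then show False
        using n x dvd_imp_le_int[of x "int (n + 2)"] by force
    qed
    then show "\<forall>\<^sub>F n in sequentially. h n x \<noteq> \<one>\<^bsub>integer_mod_group (n + 2)\<^esub>"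
      unfolding eventually_sequentially by (intro exI[of _ "nat \<bar>x\<bar> + 1"]) simp
  qed simp_all
  show "\<not> openin marked_groups ?I"
  proof
    assume op: "openin marked_groups ?I"
    have "marked_quotient 1 integer_group f \<in> ?I"
      using isolated_left_order_marked_quotient[OF group_integer_group f] surj_f
        isolated_left_order_integer_group marked_quotient_in_topspace[OF group_integer_group f]
      by simp
    then have "\<forall>\<^sub>F n in sequentially. marked_quotient 1 (integer_mod_group (n + 2)) (h n \<circ> f) \<in> ?I"
      using lim op unfolding limitin_def by blast
    then obtain n where n: "marked_quotient 1 (integer_mod_group (n + 2)) (h n \<circ> f) \<in> ?I"
      unfolding eventually_sequentially by blast
    have "(h n \<circ> f) ` carrier (free_group 1) = carrier (integer_mod_group (n + 2))"
    proof -
      have "y = h n y" if "y \<in> carrier (integer_mod_group (n + 2))" for y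
        using that by (simp add: h_def carrier_integer_mod_group)
      then show ?thesis
        using surj_f h[of n] unfolding image_comp[symmetric] by (auto simp: hom_def)
    qed
    then have "\<exists>R. isolated_left_order (integer_mod_group (n + 2)) R"
      using n isolated_left_order_marked_quotient[OF group_integer_mod_group hom_compose[OF f h]]
      by blast
    moreover have "left_orders (integer_mod_group (n + 2)) = {}"
      by (rule left_orders_finite_group[of _ 1]) (simp_all add: carrier_integer_mod_group)
    ultimately show False
      by (simp add: isolated_left_order_iff)
  qed
qed

end
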